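(* Let $(X_n,\Phi_n)$ and $(Y_n,\Psi_n)$ be two $D_+$-chains. Then there is a common zig-zag $D_+$-chain of $(X_n,\Phi_n)$ and $(Y_n,\Psi_n)$ if and only if $end(X_n,\Phi_n)$ and $end(Y_n,\Psi_n)$ are asymorphic.
   Context: $\mathbb N=\{1,2,\dots\}$. Asymorphism: a multi-map $\Phi\colon X\Rightarrow Y$ is a subset $\Phi\subset X\times Y$; $\Phi(A)=\{y:\exists a\in A,\ (a,y)\in\Phi\}$; $\Phi^{-1}=\{(y,x):(x,y)\in\Phi\}$; $\Phi$ is surjective if $\Phi(X)=Y$. A multi-map between metric spaces is bornologous if there is a non-decreasing $\varrho\colon[0,\infty)\to[0,\infty)$ with $\operatorname{diam}(\Phi(A))\le\varrho(\operatorname{diam}(A))$ for every bounded $A\subset X$. $\Phi$ is an asymorphism if both $\Phi$ and $\Phi^{-1}$ are surjective and bornologous; $X,Y$ are asymorphic if an asymorphism $X\Rightarrow Y$ exists. $D_+$-chain: a sequence of sets $X_n$ ($n\in\mathbb N$) and surjective maps $\Phi_n\colon X_n\to X_{n+1}$ whose direct limit is trivial (a single point); in particular, for all $x_i\in X_i$, $x_j\in X_j$ there is $k>i,j$ such that $x_i$ and $x_j$ have the same image in $X_k$. End space: $end(X_n,\Phi_n)=\{(x_n)_{n\in\mathbb N}:x_n\in X_n,\ \Phi_n(x_n)=x_{n+1}\}$ with the ultrametric $D((x_n),(y_n))=2^{n_0}$, $n_0=\min\{n:x_n=y_n\}$, for distinct sequences, and $D=0$ for equal sequences. Subchain: for a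 (strictly) increasing $\alpha\colon\mathbb N\to\mathbb N$, the $\alpha$-subchain is $(X_{\alpha(n)},\tilde\Phi_n)$ with $\tilde\Phi_n=\Phi_{\alpha(n+1)-1}\circ\cdots\circ\Phi_{\alpha(n)}\colon X_{\alpha(n)}\to X_{\alpha(n+1)}$. Common zig-zag $D_+$-chain: a $D_+$-chain $(Z_n,\mathcal V_n)$ is a common zig-zag $D_+$-chain of $(X_n,\Phi_n)$ and $(Y_n,\Psi_n)$ if there are increasing $\alpha,\beta\colon\mathbb N\to\mathbb N$ such that $Z_{2n-1}=X_{\alpha(n)}$, $Z_{2n}=Y_{\beta(n)}$ for all $n\ge1$ (so $\mathcal V_{2n-1}\colon X_{\alpha(n)}\to Y_{\beta(n)}$ and $\mathcal V_{2n}\colon Y_{\beta(n)}\to X_{\alpha(n+1)}$), and $\mathcal V_{2n}\circ\mathcal V_{2n-1}=\tilde\Phi_n$, $\mathcal V_{2n+1}\circ\mathcal V_{2n}=\tilde\Psi_n$ for all $n$, where $(X_{\alpha(n)},\tilde\Phi_n)$ and $(Y_{\beta(n)},\tilde\Psi_n)$ are the corresponding subchains. *)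

theory Defs
  imports "HOL-Analysis.Abstract_Metric_Spaces" "HOL-Library.Extended_Nonnegative_Real"
begin

text \<open>
  A metric space is a pair \<open>M\<close>, \<open>d\<close> with \<^locale>\<open>Metric_space\<close>.
  Diameters take the value \<open>\<infinity>\<close> on unbounded sets; the diameter of the empty set is \<open>0\<close>.
\<close>

definition ediam :: "('a \<Rightarrow> 'a \<Rightarrow> real) \<Rightarrow> 'a set \<Rightarrow> ennreal" where
  "ediam d A = (SUP x\<in>A. SUP y\<in>A. ennreal (d x y))"

definition bornologous ::
    "'a set \<Rightarrow> ('a \<Rightarrow> 'a \<Rightarrow> real) \<Rightarrow> ('b \<Rightarrow> 'b \<Rightarrow> real) \<Rightarrow> ('a \<times> 'b) set \<Rightarrow> bool" where
  "bornologous M d d' \<Phi> \<longleftrightarrow>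
     (\<exists>\<rho> :: real \<Rightarrow> real. mono_on {0..} \<rho> \<and> \<rho> \<in> {0..} \<rightarrow> {0..} \<and>
        (\<forall>A. A \<subseteq> M \<and> Metric_space.mbounded M d A \<longrightarrow>
             ediam d' (\<Phi> `` A) \<le> ennreal (\<rho> (enn2real (ediam d A)))))"

definition asymorphism ::
    "'a set \<Rightarrow> ('a \<Rightarrow> 'a \<Rightarrow> real) \<Rightarrow> 'b set \<Rightarrow> ('b \<Rightarrow> 'b \<Rightarrow> real) \<Rightarrow> ('a \<times> 'b) set \<Rightarrow> bool" where
  "asymorphism M d M' d' \<Phi> \<longleftrightarrow>
     \<Phi> \<subseteq> M \<times> M' \<and>
     \<Phi> `` M = M' \<and> bornologous M d d' \<Phi> \<and>
     \<Phi>\<inverse> `` M' = M \<and> bornologous M' d' d (\<Phi>\<inverse>)"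

definition asymorphic ::
    "'a set \<Rightarrow> ('a \<Rightarrow> 'a \<Rightarrow> real) \<Rightarrow> 'b set \<Rightarrow> ('b \<Rightarrow> 'b \<Rightarrow> real) \<Rightarrow> bool" where
  "asymorphic M d M' d' \<longleftrightarrow> (\<exists>\<Phi>. asymorphism M d M' d' \<Phi>)"

text \<open>
  Indices run over \<open>{1..}\<close>; the values \<open>X 0\<close> and \<open>\<Phi> 0\<close> are irrelevant.
  The composite \<open>\<Phi>\<^bsub>j-1\<^esub> \<circ> \<dots> \<circ> \<Phi>\<^bsub>i\<^esub>\<close> (the identity if \<open>j \<le> i\<close>) is written with
  \<^const>\<open>fold\<close>, which applies \<open>\<Phi> i\<close> first.
\<close>

definition chain_map :: "(nat \<Rightarrow> 'a \<Rightarrow> 'a) \<Rightarrow> nat \<Rightarrow> nat \<Rightarrow> 'a \<Rightarrow> 'a" where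
  "chain_map \<Phi> i j = fold \<Phi> [i..<j]"

lemma chain_map_refl [simp]: "chain_map \<Phi> i i x = x"
  by (simp add: chain_map_def)

lemma chain_map_Suc: "i \<le> j \<Longrightarrow> chain_map \<Phi> i (Suc j) x = \<Phi> j (chain_map \<Phi> i j x)"
  by (simp add: chain_map_def)

definition direct_limit_rel ::
    "(nat \<Rightarrow> 'a set) \<Rightarrow> (nat \<Rightarrow> 'a \<Rightarrow> 'a) \<Rightarrow> ((nat \<times> 'a) \<times> (nat \<times> 'a)) set" where
  "direct_limit_rel X \<Phi> =
     {((i, x), (j, y)). i \<ge> 1 \<and> x \<in> X i \<and> j \<ge> 1 \<and> y \<in> X j \<and>
        (\<exists>k. i \<le> k \<and> j \<le> k \<and> chain_map \<Phi> i k x = chain_map \<Phi> j k y)}"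

definition direct_limit ::
    "(nat \<Rightarrow> 'a set) \<Rightarrow> (nat \<Rightarrow> 'a \<Rightarrow> 'a) \<Rightarrow> (nat \<times> 'a) set set" where
  "direct_limit X \<Phi> = (SIGMA n:{1..}. X n) // direct_limit_rel X \<Phi>"

definition D_plus_chain :: "(nat \<Rightarrow> 'a set) \<Rightarrow> (nat \<Rightarrow> 'a \<Rightarrow> 'a) \<Rightarrow> bool" where
  "D_plus_chain X \<Phi> \<longleftrightarrow>
     (\<forall>n\<ge>1. \<Phi> n ` X n = X (Suc n)) \<and> is_singleton (direct_limit X \<Phi>)"

text \<open>Sequences indexed by \<open>{1..}\<close> are functions that are \<^const>\<open>undefined\<close> at \<open>0\<close>.\<close>

definition end_space :: "(nat \<Rightarrow> 'a set) \<Rightarrow> (nat \<Rightarrow> 'a \<Rightarrow> 'a) \<Rightarrow> (nat \<Rightarrow> 'a) set" where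
  "end_space X \<Phi> = {x \<in> Pi\<^sub>E {1..} X. \<forall>n\<ge>1. \<Phi> n (x n) = x (Suc n)}"

definition end_dist :: "(nat \<Rightarrow> 'a) \<Rightarrow> (nat \<Rightarrow> 'a) \<Rightarrow> real" where
  "end_dist x y = (if x = y then 0 else 2 ^ (LEAST n. n \<ge> 1 \<and> x n = y n))"

definition index_map :: "(nat \<Rightarrow> nat) \<Rightarrow> bool" where
  "index_map \<alpha> \<longleftrightarrow> \<alpha> \<in> {1..} \<rightarrow> {1..} \<and> strict_mono_on {1..} \<alpha>"

definition subchain_map :: "(nat \<Rightarrow> nat) \<Rightarrow> (nat \<Rightarrow> 'a \<Rightarrow> 'a) \<Rightarrow> nat \<Rightarrow> 'a \<Rightarrow> 'a" where
  "subchain_map \<alpha> \<Phi> n = chain_map \<Phi> (\<alpha> n) (\<alpha> (Suc n))"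

text \<open>
  As \<open>X\<close> and \<open>Y\<close> live in different types, the zig-zag chain lives in their sum, and
  \<open>Z\<^bsub>2n-1\<^esub> = X\<^bsub>\<alpha>(n)\<^esub>\<close>, \<open>Z\<^bsub>2n\<^esub> = Y\<^bsub>\<beta>(n)\<^esub>\<close> are read through \<^const>\<open>Inl\<close> and \<^const>\<open>Inr\<close>.
\<close>

definition common_zigzag ::
    "(nat \<Rightarrow> 'a set) \<Rightarrow> (nat \<Rightarrow> 'a \<Rightarrow> 'a) \<Rightarrow> (nat \<Rightarrow> 'b set) \<Rightarrow> (nat \<Rightarrow> 'b \<Rightarrow> 'b) \<Rightarrow>
     (nat \<Rightarrow> ('a + 'b) set) \<Rightarrow> (nat \<Rightarrow> 'a + 'b \<Rightarrow> 'a + 'b) \<Rightarrow> bool" where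
  "common_zigzag X \<Phi> Y \<Psi> Z \<V> \<longleftrightarrow>
     D_plus_chain Z \<V> \<and>
     (\<exists>\<alpha> \<beta>. index_map \<alpha> \<and> index_map \<beta> \<and>
        (\<forall>n\<ge>1. Z (2 * n - 1) = Inl ` X (\<alpha> n) \<and> Z (2 * n) = Inr ` Y (\<beta> n) \<and>
          (\<forall>x\<in>X (\<alpha> n). \<V> (2 * n) (\<V> (2 * n - 1) (Inl x)) = Inl (subchain_map \<alpha> \<Phi> n x)) \<and>
          (\<forall>y\<in>Y (\<beta> n). \<V> (2 * n + 1) (\<V> (2 * n) (Inr y)) = Inr (subchain_map \<beta> \<Psi> n y))))"

lemma chain_map_trans:
  assumes "i \<le> j" "j \<le> k"
  shows "chain_map \<Phi> i k x = chain_map \<Phi> j k (chain_map \<Phi> i j x)"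
  using assms(2,1) by (induction rule: dec_induct) (auto simp: chain_map_Suc)

lemma equiv_direct_limit_rel:
  "equiv (SIGMA n:{1..}. X n) (direct_limit_rel X \<Phi>)"
proof (rule equivI)
  show "direct_limit_rel X \<Phi> \<subseteq> (SIGMA n:{1..}. X n) \<times> (SIGMA n:{1..}. X n)"
    by (auto simp: direct_limit_rel_def)
  show "refl_on (SIGMA n:{1..}. X n) (direct_limit_rel X \<Phi>)"
    by (auto simp: direct_limit_rel_def refl_on_def)
  show "sym (direct_limit_rel X \<Phi>)"
    unfolding sym_def direct_limit_rel_def by (clarsimp) metis
  show "trans (direct_limit_rel X \<Phi>)"
  proof (rule transI)
    fix p q r
    assume pq: "(p, q) \<in> direct_limit_rel X \<Phi>" and qr: "(q, r) \<in> direct_limit_rel X \<Phi>"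
    obtain i x j y l z where e: "p = (i, x)" "q = (j, y)" "r = (l, z)"
      by (metis surj_pair)
    from pq e obtain k where k: "i \<le> k" "j \<le> k" "chain_map \<Phi> i k x = chain_map \<Phi> j k y"
      by (auto simp: direct_limit_rel_def)
    from qr e obtain m where m: "j \<le> m" "l \<le> m" "chain_map \<Phi> j m y = chain_map \<Phi> l m z"
      by (auto simp: direct_limit_rel_def)
    have "chain_map \<Phi> i (max k m) x = chain_map \<Phi> l (max k m) z"
      using k m by (metis chain_map_trans max.cobounded1 max.cobounded2)
    with k m pq qr e show "(p, r) \<in> direct_limit_rel X \<Phi>"
      by (auto simp: direct_limit_rel_def intro!: exI[of _ "max k m"])
  qed
qed

lemma D_plus_chain_merge:
  assumes "D_plus_chain X \<Phi>" "i \<ge> 1" "x \<in> X i" "j \<ge> 1" "y \<in> X j"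
  obtains k where "i < k" "j < k" "chain_map \<Phi> i k x = chain_map \<Phi> j k y"
proof -
  let ?S = "SIGMA n:{1..}. X n" and ?R = "direct_limit_rel X \<Phi>"
  obtain c where c: "?S // ?R = {c}"
    using assms(1) by (auto simp: D_plus_chain_def direct_limit_def is_singleton_def)
  have "(i, x) \<in> ?S" "(j, y) \<in> ?S" using assms by auto
  then have "?R `` {(i, x)} = ?R `` {(j, y)}"
    using c quotientI[of _ ?S ?R] by (metis singletonD)
  then have "((i, x), (j, y)) \<in> ?R"
    using eq_equiv_class[OF _ equiv_direct_limit_rel \<open>(j, y) \<in> ?S\<close>] by simp
  then obtain k where k: "i \<le> k" "j \<le> k" "chain_map \<Phi> i k x = chain_map \<Phi> j k y"
    by (auto simp: direct_limit_rel_def)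
  then have "chain_map \<Phi> i (Suc k) x = chain_map \<Phi> j (Suc k) y"
    by (simp add: chain_map_Suc)
  with k that[of "Suc k"] show ?thesis by simp
qed

lemma end_space_chain_map:
  assumes "x \<in> end_space X \<Phi>" "1 \<le> i" "i \<le> j"
  shows "chain_map \<Phi> i j (x i) = x j"
  using assms(3,1,2)
  by (induction rule: dec_induct) (auto simp: end_space_def chain_map_Suc)

lemma end_space_meet:
  assumes "D_plus_chain X \<Phi>" "x \<in> end_space X \<Phi>" "y \<in> end_space X \<Phi>"
  obtains n where "n \<ge> 1" "x n = y n"
proof -
  have "x 1 \<in> X 1" "y 1 \<in> X 1"
    using assms by (auto simp: end_space_def)
  then obtain k where "1 < k" "chain_map \<Phi> 1 k (x 1) = chain_map \<Phi> 1 k (y 1)"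
    using D_plus_chain_merge[OF assms(1), of 1 _ 1] by (metis le_refl)
  then show ?thesis
    using that[of k] end_space_chain_map[OF assms(2), of 1 k]
      end_space_chain_map[OF assms(3), of 1 k] by simp
qed

lemma end_dist_ultrametric:
  assumes X: "D_plus_chain X \<Phi>" and xyz: "x \<in> end_space X \<Phi>" "y \<in> end_space X \<Phi>" "z \<in> end_space X \<Phi>"
  shows "end_dist x z \<le> max (end_dist x y) (end_dist y z)"
proof (cases "x = y \<or> y = z \<or> x = z")
  case True
  then show ?thesis by (auto simp: end_dist_def le_max_iff_disj)
next
  case False
  let ?L = "\<lambda>x y :: nat \<Rightarrow> 'a. LEAST n. n \<ge> 1 \<and> x n = y n"
  have L: "?L u v \<ge> 1 \<and> u (?L u v) = v (?L u v)"
    if "u \<in> end_space X \<Phi>" "v \<in> end_space X \<Phi>" for u v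
    using end_space_meet[OF X that] by (metis (mono_tags, lifting) LeastI)
  let ?m = "max (?L x y) (?L y z)"
  have eq: "u n = v n" if "u \<in> end_space X \<Phi>" "v \<in> end_space X \<Phi>" "n \<ge> ?L u v" for u v n
    using L[OF that(1,2)] that(3) end_space_chain_map[OF that(1), of "?L u v" n]
      end_space_chain_map[OF that(2), of "?L u v" n] by simp
  have "x ?m = z ?m"
    using eq[OF xyz(1,2), of ?m] eq[OF xyz(2,3), of ?m] by simp
  moreover have "?m \<ge> 1" using L[OF xyz(1,2)] by (simp add: le_max_iff_disj)
  ultimately have "?L x z \<le> ?m" by (intro Least_le) simp
  then have "(2::real) ^ ?L x z \<le> 2 ^ ?m" by (intro power_increasing) auto
  also have "\<dots> = max (2 ^ ?L x y) (2 ^ ?L y z)"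
    by (auto simp: max_def)
  finally show ?thesis using False by (simp add: end_dist_def)
qed

lemma Metric_space_end_space:
  assumes "D_plus_chain X \<Phi>"
  shows "Metric_space (end_space X \<Phi>) end_dist"
proof
  show nonneg: "0 \<le> end_dist x y" for x y :: "nat \<Rightarrow> 'a" by (simp add: end_dist_def)
  show "end_dist x z \<le> end_dist x y + end_dist y z"
    if "x \<in> end_space X \<Phi>" "y \<in> end_space X \<Phi>" "z \<in> end_space X \<Phi>" for x y z
    using end_dist_ultrametric[OF assms that] nonneg[of x y] nonneg[of y z] by linarith
  show "end_dist x y = end_dist y x" for x y :: "nat \<Rightarrow> 'a"
    by (simp add: end_dist_def eq_commute)
  show "end_dist x y = 0 \<longleftrightarrow> x = y" for x y :: "nat \<Rightarrow> 'a" by (simp add: end_dist_def)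
qed

end

theory Submission imports Defs begin

text \<open>
  In an end space, \<open>D(x, x') \<le> 2\<^sup>n\<close> says that \<open>x\<^sub>n = x'\<^sub>n\<close>, and then the two sequences agree from
  \<open>n\<close> on. A multi-map \<open>R\<close> between end spaces is therefore bornologous iff every \<open>n\<close> has an \<open>m\<close>
  such that, for all \<open>(x, y), (x', y') \<in> R\<close>, agreement of \<open>x, x'\<close> at \<open>n\<close> forces agreement of
  \<open>y, y'\<close> at \<open>m\<close> (\<open>end_space_bornologous_iff\<close>); so there is a map from \<open>X\<^sub>n\<close> to \<open>Y\<^sub>m\<close> that
  sends \<open>x\<^sub>n\<close> to \<open>y\<^sub>m\<close> for every pair of \<open>R\<close>. These are the maps of a zig-zag.

  Given a zig-zag, relate \<open>x\<close> and \<open>y\<close> when all the maps from the \<open>X\<close>-side to the \<open>Y\<close>-side send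
  the entries of \<open>x\<close> to those of \<open>y\<close>. The triangles carry this condition from one stage to the
  next, so it needs checking at the first stage alone, and surjectivity there provides a partner for
  every point on either side. The maps of the zig-zag transport agreement in both directions.

  Given an asymorphism \<open>R\<close>, choose levels \<open>s\<^sub>1 < s\<^sub>2 < \<dots>\<close> growing so fast that agreement at
  \<open>s\<^sub>k\<close> on one side forces agreement at \<open>s\<^sub>k\<^sub>+\<^sub>1\<close> on the other. Every pair \<open>(x, y)\<close> of \<open>R\<close>
  then gives an alternating sequence of the entries of \<open>x\<close> at odd stages and of \<open>y\<close> at even
  stages. The next entry of such a sequence depends only on the current one, which defines the maps
  of the zig-zag; surjectivity, the triangles and the triviality of the limit can be read off from
  these sequences, because they pass through every point of the sets in question.
\<close>

section \<open>Bornologous multi-maps\<close>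

lemma ediam_le_iff: "ediam d A \<le> c \<longleftrightarrow> (\<forall>x\<in>A. \<forall>y\<in>A. ennreal (d x y) \<le> c)"
  by (simp add: ediam_def SUP_le_iff)

text \<open>
  Two-point sets suffice to test a bornologous multi-map: a bound on the distance between two points
  of \<open>R `` A\<close> needs only the two points of \<open>A\<close> from which they come. Monotonicity of the
  control function costs nothing either, since bounds at the integers can be summed up.
\<close>

lemma bornologous_iff:
  assumes M: "Metric_space M d" and M': "Metric_space M' d'" and R: "R \<subseteq> M \<times> M'"
  shows "bornologous M d d' R \<longleftrightarrow>
    (\<forall>r\<ge>0. \<exists>s. \<forall>(x, y)\<in>R. \<forall>(x', y')\<in>R. d x x' \<le> r \<longrightarrow> d' y y' \<le> s)" (is "_ \<longleftrightarrow> ?control")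
proof
  assume "bornologous M d d' R"
  then obtain \<rho> :: "real \<Rightarrow> real" where mono: "mono_on {0..} \<rho>" and pos: "\<rho> \<in> {0..} \<rightarrow> {0..}"
    and \<rho>: "\<And>A. A \<subseteq> M \<Longrightarrow> Metric_space.mbounded M d A \<Longrightarrow>
      ediam d' (R `` A) \<le> ennreal (\<rho> (enn2real (ediam d A)))"
    unfolding bornologous_def by auto
  show ?control
  proof (intro allI impI exI ballI, clarify)
    fix r x y x' y'
    assume r: "0 \<le> (r::real)" and xy: "(x, y) \<in> R" "(x', y') \<in> R" and le: "d x x' \<le> r"
    let ?A = "{x, x'}"
    have A: "?A \<subseteq> M" using xy R by auto
    have diam: "ediam d ?A \<le> ennreal r"
      unfolding ediam_le_iff using le r A
      by (auto simp: Metric_space.commute[OF M] Metric_space.mdist_zero[OF M] intro!: ennreal_leI)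
    then have "enn2real (ediam d ?A) \<le> r"
      using r by (metis enn2real_leI)
    then have "\<rho> (enn2real (ediam d ?A)) \<le> \<rho> r"
      using r by (intro mono_onD[OF mono]) auto
    moreover have "ennreal (d' y y') \<le> ediam d' (R `` ?A)"
      using xy ediam_le_iff[of d' "R `` ?A" "ediam d' (R `` ?A)"] by blast
    moreover have "ediam d' (R `` ?A) \<le> ennreal (\<rho> (enn2real (ediam d ?A)))"
      using A by (intro \<rho>) (auto simp: Metric_space.mbounded_insert[OF M] Metric_space.mbounded_empty[OF M])
    ultimately have "ennreal (d' y y') \<le> ennreal (\<rho> r)"
      by (meson ennreal_leI order_trans)
    moreover have "\<rho> r \<ge> 0" using pos r by auto
    ultimately show "d' y y' \<le> \<rho> r" by (simp add: ennreal_le_iff)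
  qed
next
  assume ?control
  then have "\<forall>r. \<exists>s. r \<ge> 0 \<longrightarrow> (\<forall>(x, y)\<in>R. \<forall>(x', y')\<in>R. d x x' \<le> r \<longrightarrow> d' y y' \<le> s)"
    by blast
  from choice[OF this] obtain s where
    s: "\<And>r. r \<ge> 0 \<Longrightarrow> \<forall>(x, y)\<in>R. \<forall>(x', y')\<in>R. d x x' \<le> r \<longrightarrow> d' y y' \<le> s r"
    by blast
  \<comment> \<open>The bound \<open>s\<close> need be neither monotone nor nonnegative; a sum of absolute values is both.\<close>
  define \<rho> :: "real \<Rightarrow> real" where "\<rho> r = (\<Sum>i\<le>nat \<lceil>r\<rceil>. \<bar>s (real i)\<bar>)" for r
  have \<rho>: "d' y y' \<le> \<rho> r" if "(x, y) \<in> R" "(x', y') \<in> R" "d x x' \<le> r" for r x y x' y'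
  proof -
    have "d x x' \<le> real (nat \<lceil>r\<rceil>)" using that(3) by linarith
    then have "d' y y' \<le> \<bar>s (real (nat \<lceil>r\<rceil>))\<bar>"
      using s[of "real (nat \<lceil>r\<rceil>)"] that(1,2) by fastforce
    also have "\<dots> \<le> \<rho> r" unfolding \<rho>_def by (rule member_le_sum) auto
    finally show ?thesis .
  qed
  have "mono_on {0..} \<rho>"
  proof (rule mono_onI)
    fix r t :: real assume "r \<le> t"
    then have "nat \<lceil>r\<rceil> \<le> nat \<lceil>t\<rceil>" by (intro nat_mono ceiling_mono)
    then show "\<rho> r \<le> \<rho> t" unfolding \<rho>_def by (intro sum_mono2) auto
  qed
  moreover have "\<rho> \<in> {0..} \<rightarrow> {0..}" by (auto simp: \<rho>_def intro: sum_nonneg)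
  moreover have "ediam d' (R `` A) \<le> ennreal (\<rho> (enn2real (ediam d A)))"
    if A: "A \<subseteq> M" "Metric_space.mbounded M d A" for A
  proof -
    obtain B where B: "\<And>x y. x \<in> A \<Longrightarrow> y \<in> A \<Longrightarrow> d x y \<le> B"
      using A(2) unfolding Metric_space.mbounded_alt[OF M] by blast
    have "ediam d A \<le> ennreal B" unfolding ediam_le_iff using B by (blast intro: ennreal_leI)
    then have fin: "ediam d A < top" by (metis ennreal_less_top order_le_less_trans)
    have "d x x' \<le> enn2real (ediam d A)" if "x \<in> A" "x' \<in> A" for x x'
    proof -
      have "ennreal (d x x') \<le> ediam d A" using that ediam_le_iff[of d A "ediam d A"] by blast
      then show ?thesis using fin enn2real_mono Metric_space.nonneg[OF M]
        by (metis enn2real_ennreal)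
    qed
    then show ?thesis unfolding ediam_le_iff using \<rho> by (blast intro: ennreal_leI)
  qed
  ultimately show "bornologous M d d' R" unfolding bornologous_def by blast
qed

section \<open>End spaces\<close>

lemma end_space_eq_mono:
  assumes "x \<in> end_space X \<Phi>" "y \<in> end_space X \<Phi>" "1 \<le> i" "i \<le> j" "x i = y i"
  shows "x j = y j"
  using assms by (metis end_space_chain_map)

lemma end_space_in: "x \<in> end_space X \<Phi> \<Longrightarrow> n \<ge> 1 \<Longrightarrow> x n \<in> X n"
  by (auto simp: end_space_def)

text \<open>
  A bound by a power of two is an equation between entries, because agreement persists along the
  sequences.
\<close>

lemma end_dist_le_iff:
  assumes "D_plus_chain X \<Phi>" "x \<in> end_space X \<Phi>" "y \<in> end_space X \<Phi>" "n \<ge> 1"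
  shows "end_dist x y \<le> 2 ^ n \<longleftrightarrow> x n = y n"
proof (cases "x = y")
  case False
  let ?L = "LEAST n. n \<ge> 1 \<and> x n = y n"
  have L: "?L \<ge> 1 \<and> x ?L = y ?L"
    using end_space_meet[OF assms(1-3)] by (metis (mono_tags, lifting) LeastI)
  have "?L \<le> n \<longleftrightarrow> x n = y n"
    using L assms(4) end_space_eq_mono[OF assms(2,3)] by (auto intro: Least_le)
  with False show ?thesis by (simp add: end_dist_def)
qed (simp add: end_dist_def)

text \<open>
  Powers of two are cofinal among the radii, so the distance bounds of \<open>bornologous_iff\<close> can be
  replaced by agreement at an index.
\<close>

lemma end_space_bornologous_iff:
  assumes X: "D_plus_chain X \<Phi>" and Y: "D_plus_chain Y \<Psi>"
    and R: "R \<subseteq> end_space X \<Phi> \<times> end_space Y \<Psi>"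
  shows "bornologous (end_space X \<Phi>) end_dist end_dist R \<longleftrightarrow>
    (\<forall>n\<ge>1. \<exists>m\<ge>1. \<forall>(x, y)\<in>R. \<forall>(x', y')\<in>R. x n = x' n \<longrightarrow> y m = y' m)" (is "?born \<longleftrightarrow> ?agree")
proof -
  have control: "?born \<longleftrightarrow>
      (\<forall>r\<ge>0. \<exists>s. \<forall>(x, y)\<in>R. \<forall>(x', y')\<in>R. end_dist x x' \<le> r \<longrightarrow> end_dist y y' \<le> s)"
    by (rule bornologous_iff[OF Metric_space_end_space[OF X] Metric_space_end_space[OF Y] R])
  have large: "\<exists>n\<ge>1. r \<le> 2 ^ n" for r :: real
  proof -
    obtain n where "r < 2 ^ n" using real_arch_pow[of 2 r] by auto
    moreover have "(2::real) ^ n \<le> 2 ^ Suc n" by simp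
    ultimately have "r \<le> 2 ^ Suc n" by linarith
    then show ?thesis by (intro exI[of _ "Suc n"]) simp
  qed
  have inX: "end_dist x x' \<le> 2 ^ n \<longleftrightarrow> x n = x' n" 
    if "(x, y) \<in> R" "(x', y') \<in> R" "n \<ge> 1" for x x' y y' n
    using end_dist_le_iff[OF X _ _ that(3)] that R by blast
  have inY: "end_dist y y' \<le> 2 ^ n \<longleftrightarrow> y n = y' n" 
    if "(x, y) \<in> R" "(x', y') \<in> R" "n \<ge> 1" for x x' y y' n
    using end_dist_le_iff[OF Y _ _ that(3)] that R by blast
  show ?thesis
  proof
    assume ?born
    show ?agree
    proof (intro allI impI)
      fix n :: nat assume n: "n \<ge> 1"
      obtain s where s: "\<forall>(x, y)\<in>R. \<forall>(x', y')\<in>R. end_dist x x' \<le> 2 ^ n \<longrightarrow> end_dist y y' \<le> s"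
        using \<open>?born\<close> unfolding control by (meson zero_le_numeral zero_le_power)
      obtain m where m: "m \<ge> 1" "s \<le> 2 ^ m" using large by blast
      have "y m = y' m" if "(x, y) \<in> R" "(x', y') \<in> R" "x n = x' n" for x y x' y'
        using s that inX[OF that(1,2) n] inY[OF that(1,2) m(1)] m(2) by fastforce
      with m(1) show "\<exists>m\<ge>1. \<forall>(x, y)\<in>R. \<forall>(x', y')\<in>R. x n = x' n \<longrightarrow> y m = y' m" by blast
    qed
  next
    assume ?agree
    show ?born
      unfolding control
    proof (intro allI impI)
      fix r :: real
      obtain n where n: "n \<ge> 1" "r \<le> 2 ^ n" using large by blast
      obtain m where m: "m \<ge> 1" "\<forall>(x, y)\<in>R. \<forall>(x', y')\<in>R. x n = x' n \<longrightarrow> y m = y' m"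
        using \<open>?agree\<close> n(1) by blast
      have "end_dist y y' \<le> 2 ^ m" if "(x, y) \<in> R" "(x', y') \<in> R" "end_dist x x' \<le> r" for x y x' y'
      proof -
        have "x n = x' n" using inX[OF that(1,2) n(1)] that(3) n(2) by linarith
        then show ?thesis using m(2) that inY[OF that(1,2) m(1)] by blast
      qed
      then show "\<exists>s. \<forall>(x, y)\<in>R. \<forall>(x', y')\<in>R. end_dist x x' \<le> r \<longrightarrow> end_dist y y' \<le> s" by blast
    qed
  qed
qed

lemma bornologous_end_space_modulus:
  assumes X: "D_plus_chain X \<Phi>" and Y: "D_plus_chain Y \<Psi>"
    and R: "R \<subseteq> end_space X \<Phi> \<times> end_space Y \<Psi>"
    and born: "bornologous (end_space X \<Phi>) end_dist end_dist R"
  obtains f where "\<And>n. n \<ge> 1 \<Longrightarrow> f n \<ge> 1"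
    and "\<And>n x y x' y'. n \<ge> 1 \<Longrightarrow> (x, y) \<in> R \<Longrightarrow> (x', y') \<in> R \<Longrightarrow> x n = x' n \<Longrightarrow> y (f n) = y' (f n)"
proof -
  have "\<forall>n. \<exists>m. n \<ge> 1 \<longrightarrow> m \<ge> 1 \<and> (\<forall>(x, y)\<in>R. \<forall>(x', y')\<in>R. x n = x' n \<longrightarrow> y m = y' m)"
    using born unfolding end_space_bornologous_iff[OF X Y R] by blast
  from choice[OF this] obtain f where
    f: "\<And>n. n \<ge> 1 \<Longrightarrow> f n \<ge> 1 \<and> (\<forall>(x, y)\<in>R. \<forall>(x', y')\<in>R. x n = x' n \<longrightarrow> y (f n) = y' (f n))"
    by blast
  show ?thesis by (rule that[of f]) (use f in blast)+
qed

lemma chain_map_image: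
  assumes "\<forall>n\<ge>1. \<Phi> n ` X n = X (Suc n)" "1 \<le> i" "i \<le> j"
  shows "chain_map \<Phi> i j ` X i = X j"
  using assms(3,2)
proof (induction rule: dec_induct)
  case (step j)
  have "chain_map \<Phi> i (Suc j) ` X i = \<Phi> j ` chain_map \<Phi> i j ` X i"
    using step.hyps by (auto simp: chain_map_Suc image_image)
  then show ?case using step assms(1) by simp
qed simp

text \<open>
  The maps are surjective, so the given entry lifts back to an entry at the first index, whose images
  form the sequence.
\<close>

lemma end_space_through:
  assumes surj: "\<forall>n\<ge>1. \<Phi> n ` X n = X (Suc n)" and "n \<ge> 1" "a \<in> X n"
  obtains x where "x \<in> end_space X \<Phi>" "x n = a"
proof -
  have "a \<in> chain_map \<Phi> 1 n ` X 1"
    using chain_map_image[OF surj order_refl assms(2)] assms(3) by simp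
  then obtain b where b: "b \<in> X 1" "chain_map \<Phi> 1 n b = a" by auto
  let ?x = "\<lambda>k\<in>{1..}. chain_map \<Phi> 1 k b"
  have "chain_map \<Phi> 1 k b \<in> X k" if "k \<ge> 1" for k
    using chain_map_image[OF surj order_refl that] b(1) by auto
  then have "?x \<in> end_space X \<Phi>"
    by (auto simp: end_space_def chain_map_Suc)
  with b(2) assms(2) that show ?thesis by simp
qed

text \<open>
  A converse to \<open>D_plus_chain_merge\<close>: if any two elements merge, all of them lie in a single
  class of the direct limit, and nonemptiness of the first set ensures that this class exists.
\<close>

lemma D_plus_chainI:
  assumes "\<forall>n\<ge>1. \<Phi> n ` X n = X (Suc n)" "X 1 \<noteq> {}"
    and merge: "\<And>i j x y. i \<ge> 1 \<Longrightarrow> x \<in> X i \<Longrightarrow> j \<ge> 1 \<Longrightarrow> y \<in> X j \<Longrightarrow>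
      \<exists>k\<ge>i. k \<ge> j \<and> chain_map \<Phi> i k x = chain_map \<Phi> j k y"
  shows "D_plus_chain X \<Phi>"
proof -
  let ?S = "SIGMA n:{1..}. X n" and ?R = "direct_limit_rel X \<Phi>"
  obtain a where a: "a \<in> X 1" using assms(2) by blast
  have "?R `` {p} = ?S" if "p \<in> ?S" for p
    using that merge by (fastforce simp: direct_limit_rel_def)
  then have "direct_limit X \<Phi> = {?S}"
    using a unfolding direct_limit_def quotient_def by fastforce
  then show ?thesis using assms(1) by (simp add: D_plus_chain_def)
qed

lemma D_plus_chain_surj: "D_plus_chain X \<Phi> \<Longrightarrow> \<forall>n\<ge>1. \<Phi> n ` X n = X (Suc n)"
  by (simp add: D_plus_chain_def)

lemma D_plus_chain_nonempty:
  assumes "D_plus_chain X \<Phi>"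
  shows "X 1 \<noteq> {}"
proof
  assume "X 1 = {}"
  then have "X n = {}" if "n \<ge> 1" for n
    using chain_map_image[OF D_plus_chain_surj[OF assms] order_refl that] by auto
  then have "(SIGMA n:{1..}. X n) = {}" by auto
  then have "direct_limit X \<Phi> = {}" by (simp add: direct_limit_def)
  then show False using assms by (simp add: D_plus_chain_def is_singleton_def)
qed

section \<open>From a zig-zag to an asymorphism\<close>

lemma index_map_ge:
  assumes "index_map \<alpha>" "n \<ge> 1"
  shows "\<alpha> n \<ge> n"
  using assms(2)
proof (induction rule: dec_induct)
  case base
  then show ?case using assms(1) by (auto simp: index_map_def)
next
  case (step n)
  then have "\<alpha> n < \<alpha> (Suc n)"
    using assms(1) by (auto simp: index_map_def intro: strict_mono_onD)
  then show ?case using step.IH by simp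
qed

text \<open>
  The multi-map is not a bijection in general: it constrains the entries of \<open>y\<close> only from index
  \<open>\<beta> 1\<close> on, and those of \<open>x\<close> only from index \<open>\<alpha> 1\<close> on. Sequences that differ only in
  earlier entries are at bounded distance. As \<open>n \<le> \<alpha> n\<close>, agreement of \<open>x, x'\<close> at \<open>n\<close> reaches
  \<open>\<alpha> n\<close>, and the zig-zag map takes it to \<open>\<beta> n\<close>; from the other side, agreement at \<open>n\<close> reaches
  \<open>\<beta> n\<close> and then \<open>\<alpha> (n + 1)\<close>.
\<close>

lemma zigzag_imp_asymorphic:
  assumes X: "D_plus_chain X \<Phi>" and Y: "D_plus_chain Y \<Psi>" and Z: "common_zigzag X \<Phi> Y \<Psi> Z \<V>"
  shows "asymorphic (end_space X \<Phi>) end_dist (end_space Y \<Psi>) end_dist"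
proof -
  have ZD: "D_plus_chain Z \<V>" using Z by (simp add: common_zigzag_def)
  obtain \<alpha> \<beta> where zigzag: "index_map \<alpha> \<and> index_map \<beta> \<and>
        (\<forall>n\<ge>1. Z (2 * n - 1) = Inl ` X (\<alpha> n) \<and> Z (2 * n) = Inr ` Y (\<beta> n) \<and>
          (\<forall>x\<in>X (\<alpha> n). \<V> (2 * n) (\<V> (2 * n - 1) (Inl x)) = Inl (subchain_map \<alpha> \<Phi> n x)) \<and>
          (\<forall>y\<in>Y (\<beta> n). \<V> (2 * n + 1) (\<V> (2 * n) (Inr y)) = Inr (subchain_map \<beta> \<Psi> n y)))"
    using Z unfolding common_zigzag_def by (elim conjE exE) (rule that, intro conjI)
  from zigzag have index: "index_map \<alpha>" "index_map \<beta>" by blast+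
  have Zodd: "Z (2 * n - 1) = Inl ` X (\<alpha> n)" and Zeven: "Z (2 * n) = Inr ` Y (\<beta> n)"
    if "n \<ge> 1" for n
    using zigzag that by blast+
  have triX: "\<V> (2 * n) (\<V> (2 * n - 1) (Inl a)) = Inl (subchain_map \<alpha> \<Phi> n a)"
    if "n \<ge> 1" "a \<in> X (\<alpha> n)" for n a
    using zigzag that by blast
  have triY: "\<V> (2 * n + 1) (\<V> (2 * n) (Inr b)) = Inr (subchain_map \<beta> \<Psi> n b)"
    if "n \<ge> 1" "b \<in> Y (\<beta> n)" for n b
    using zigzag that by blast
  have ge1: "\<alpha> n \<ge> 1" "\<beta> n \<ge> 1" if "n \<ge> 1" for n
    using index_map_ge[OF index(1) that] index_map_ge[OF index(2) that] that by auto
  have le: "\<alpha> n \<le> \<alpha> (Suc n)" "\<beta> n \<le> \<beta> (Suc n)" if "n \<ge> 1" for n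
    using index that by (auto simp: index_map_def intro!: less_imp_le intro: strict_mono_onD)
  define R where "R = {(x, y). x \<in> end_space X \<Phi> \<and> y \<in> end_space Y \<Psi> \<and>
    (\<forall>n\<ge>1. \<V> (2 * n - 1) (Inl (x (\<alpha> n))) = Inr (y (\<beta> n)))}"
  have sub: "R \<subseteq> end_space X \<Phi> \<times> end_space Y \<Psi>" by (auto simp: R_def)
  \<comment> \<open>The odd maps determine what the even maps do on related sequences, by the triangles over \<open>X\<close>.\<close>
  have down: "\<V> (2 * n) (Inr (y (\<beta> n))) = Inl (x (\<alpha> (Suc n)))"
    if "x \<in> end_space X \<Phi>" "\<V> (2 * n - 1) (Inl (x (\<alpha> n))) = Inr (y (\<beta> n))" "n \<ge> 1" for x y n
    using triX[OF that(3), of "x (\<alpha> n)"] end_space_in[OF that(1) ge1(1)[OF that(3)]] that(2)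
      end_space_chain_map[OF that(1) ge1(1)[OF that(3)] le(1)[OF that(3)]]
    by (simp add: subchain_map_def)
  \<comment> \<open>Composing the two kinds of triangle carries the relation from stage \<open>n\<close> to stage \<open>n + 1\<close>.\<close>
  have RI: "(x, y) \<in> R"
    if x: "x \<in> end_space X \<Phi>" and y: "y \<in> end_space Y \<Psi>" and one: "\<V> 1 (Inl (x (\<alpha> 1))) = Inr (y (\<beta> 1))"
    for x y
  proof -
    have "\<V> (2 * n - 1) (Inl (x (\<alpha> n))) = Inr (y (\<beta> n))" if "n \<ge> 1" for n
      using that
    proof (induction rule: dec_induct)
      case base
      then show ?case using one by simp
    next
      case (step n)
      have "\<V> (2 * n + 1) (\<V> (2 * n) (Inr (y (\<beta> n)))) = Inr (y (\<beta> (Suc n)))"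
        using triY[OF step.hyps(1), of "y (\<beta> n)"] end_space_in[OF y ge1(2)[OF step.hyps(1)]]
          end_space_chain_map[OF y ge1(2)[OF step.hyps(1)] le(2)[OF step.hyps(1)]]
        by (simp add: subchain_map_def)
      then show ?case using down[OF x _ step.hyps(1), where y = y] step.IH by simp
    qed
    then show ?thesis using x y by (simp add: R_def)
  qed
  have V1: "\<V> 1 ` Inl ` X (\<alpha> 1) = Inr ` Y (\<beta> 1)"
    using D_plus_chain_surj[OF ZD, rule_format, of 1] Zodd[of 1] Zeven[of 1] by (simp add: numeral_2_eq_2)
  have total: "\<exists>y. (x, y) \<in> R" if x: "x \<in> end_space X \<Phi>" for x
  proof -
    have "x (\<alpha> 1) \<in> X (\<alpha> 1)" using end_space_in[OF x] ge1(1) by simp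
    then have "\<V> 1 (Inl (x (\<alpha> 1))) \<in> Inr ` Y (\<beta> 1)" using V1 by blast
    then obtain b where b: "b \<in> Y (\<beta> 1)" "\<V> 1 (Inl (x (\<alpha> 1))) = Inr b" by blast
    obtain y where "y \<in> end_space Y \<Psi>" "y (\<beta> 1) = b"
      using end_space_through[OF D_plus_chain_surj[OF Y] ge1(2) b(1)] by auto
    then show ?thesis using RI[OF x] b(2) by blast
  qed
  have onto: "\<exists>x. (x, y) \<in> R" if y: "y \<in> end_space Y \<Psi>" for y
  proof -
    have "y (\<beta> 1) \<in> Y (\<beta> 1)" using end_space_in[OF y] ge1(2) by simp
    then have "Inr (y (\<beta> 1)) \<in> \<V> 1 ` Inl ` X (\<alpha> 1)" using V1 by blast
    then obtain a where a: "a \<in> X (\<alpha> 1)" "\<V> 1 (Inl a) = Inr (y (\<beta> 1))" by force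
    obtain x where "x \<in> end_space X \<Phi>" "x (\<alpha> 1) = a"
      using end_space_through[OF D_plus_chain_surj[OF X] ge1(1) a(1)] by auto
    then show ?thesis using RI[OF _ y] a(2) by blast
  qed
  have forward: "y (\<beta> n) = y' (\<beta> n)"
    if "(x, y) \<in> R" "(x', y') \<in> R" "x n = x' n" "n \<ge> 1" for x y x' y' n
  proof -
    have "x (\<alpha> n) = x' (\<alpha> n)"
      using end_space_eq_mono[of x X \<Phi> x' n "\<alpha> n"] that index_map_ge[OF index(1)] by (auto simp: R_def)
    moreover have "\<V> (2 * n - 1) (Inl (x (\<alpha> n))) = Inr (y (\<beta> n))"
      "\<V> (2 * n - 1) (Inl (x' (\<alpha> n))) = Inr (y' (\<beta> n))"
      using that by (auto simp: R_def)
    ultimately show ?thesis by simp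
  qed
  have backward: "x (\<alpha> (Suc n)) = x' (\<alpha> (Suc n))"
    if "(x, y) \<in> R" "(x', y') \<in> R" "y n = y' n" "n \<ge> 1" for x y x' y' n
  proof -
    have "y (\<beta> n) = y' (\<beta> n)"
      using end_space_eq_mono[of y Y \<Psi> y' n "\<beta> n"] that index_map_ge[OF index(2)] by (auto simp: R_def)
    moreover have "\<V> (2 * n) (Inr (y (\<beta> n))) = Inl (x (\<alpha> (Suc n)))"
      "\<V> (2 * n) (Inr (y' (\<beta> n))) = Inl (x' (\<alpha> (Suc n)))"
      using down[of x n y] down[of x' n y'] that by (auto simp: R_def)
    ultimately show ?thesis by simp
  qed
  have "bornologous (end_space X \<Phi>) end_dist end_dist R"
    unfolding end_space_bornologous_iff[OF X Y sub] using forward ge1(2) by blast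
  moreover have "bornologous (end_space Y \<Psi>) end_dist end_dist (R\<inverse>)"
  proof -
    have sub': "R\<inverse> \<subseteq> end_space Y \<Psi> \<times> end_space X \<Phi>" using sub by auto
    show ?thesis
      unfolding end_space_bornologous_iff[OF Y X sub']
    proof (intro allI impI)
      fix n :: nat assume n: "n \<ge> 1"
      show "\<exists>m\<ge>1. \<forall>(y, x)\<in>R\<inverse>. \<forall>(y', x')\<in>R\<inverse>. y n = y' n \<longrightarrow> x m = x' m"
        using backward[OF _ _ _ n] ge1(1)[of "Suc n"] by (intro exI[of _ "\<alpha> (Suc n)"]) auto
    qed
  qed
  moreover have "R `` end_space X \<Phi> = end_space Y \<Psi>" using sub onto by blast
  moreover have "R\<inverse> `` end_space Y \<Psi> = end_space X \<Phi>" using sub total by blast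
  ultimately have "asymorphism (end_space X \<Phi>) end_dist (end_space Y \<Psi>) end_dist R"
    using sub by (simp add: asymorphism_def)
  then show ?thesis by (auto simp: asymorphic_def)
qed

section \<open>From an asymorphism to a zig-zag\<close>

text \<open>
  The alternating sequence traced by a pair of ends. One sequence \<open>s\<close> of levels serves both sides:
  with \<open>\<alpha> n = s (2 * n - 1)\<close> and \<open>\<beta> n = s (2 * n)\<close>, the two cases become a single
  successor step on \<open>k\<close>.
\<close>

definition strand :: "(nat \<Rightarrow> nat) \<Rightarrow> (nat \<Rightarrow> 'a) \<times> (nat \<Rightarrow> 'b) \<Rightarrow> nat \<Rightarrow> 'a + 'b" where
  "strand s p k = (if odd k then Inl (fst p (s k)) else Inr (snd p (s k)))"

text \<open>
  The sets of the zig-zag are the values of the strands of \<open>R\<close>, and its maps advance every strand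
  by one step. The growth of the levels makes this well defined.
\<close>

lemma asymorphic_imp_zigzag:
  assumes X: "D_plus_chain X \<Phi>" and Y: "D_plus_chain Y \<Psi>"
    and asym: "asymorphic (end_space X \<Phi>) end_dist (end_space Y \<Psi>) end_dist"
  shows "\<exists>Z \<V>. common_zigzag X \<Phi> Y \<Psi> Z \<V>"
proof -
  obtain R where sub: "R \<subseteq> end_space X \<Phi> \<times> end_space Y \<Psi>"
    and onto: "R `` end_space X \<Phi> = end_space Y \<Psi>"
    and total: "R\<inverse> `` end_space Y \<Psi> = end_space X \<Phi>"
    and born: "bornologous (end_space X \<Phi>) end_dist end_dist R"
    and born': "bornologous (end_space Y \<Psi>) end_dist end_dist (R\<inverse>)"
    using asym unfolding asymorphic_def asymorphism_def by blast
  have sub': "R\<inverse> \<subseteq> end_space Y \<Psi> \<times> end_space X \<Phi>" using sub by auto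
  obtain f where f1: "\<And>n. n \<ge> 1 \<Longrightarrow> f n \<ge> 1"
    and f: "\<And>n x y x' y'. n \<ge> 1 \<Longrightarrow> (x, y) \<in> R \<Longrightarrow> (x', y') \<in> R \<Longrightarrow> x n = x' n
      \<Longrightarrow> y (f n) = y' (f n)"
    by (rule bornologous_end_space_modulus[OF X Y sub born]) (rule that)
  obtain g where g1: "\<And>n. n \<ge> 1 \<Longrightarrow> g n \<ge> 1"
    and g': "\<And>n y x y' x'. n \<ge> 1 \<Longrightarrow> (y, x) \<in> R\<inverse> \<Longrightarrow> (y', x') \<in> R\<inverse> \<Longrightarrow> y n = y' n
      \<Longrightarrow> x (g n) = x' (g n)"
    by (rule bornologous_end_space_modulus[OF Y X sub' born']) (rule that)
  have g: "x (g n) = x' (g n)"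
    if "n \<ge> 1" "(x, y) \<in> R" "(x', y') \<in> R" "y n = y' n" for n x y x' y'
    using g'[of n y x y' x'] that by simp
  \<comment> \<open>The next level exceeds both moduli at the current one, so it serves either direction; since the
    moduli are positive, the levels increase strictly.\<close>
  define s where "s = rec_nat 1 (\<lambda>_ m. m + f m + g m)"
  have s_Suc: "s (Suc k) = s k + f (s k) + g (s k)" for k by (simp add: s_def)
  have s1: "s k \<ge> 1" for k by (induction k) (auto simp: s_def)
  have "s k < s (Suc k)" for k using f1[OF s1[of k]] by (simp add: s_Suc)
  then have "strict_mono s" by (simp add: strict_mono_Suc_iff)
  then have s_less: "i < j \<Longrightarrow> s i < s j" for i j by (simp add: strict_mono_less)
  have s_le: "i \<le> j \<Longrightarrow> s i \<le> s j" for i j using \<open>strict_mono s\<close> by (simp add: strict_mono_less_eq)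
  have s_ge: "k \<le> s k" for k using \<open>strict_mono s\<close> by (rule strict_mono_imp_increasing)
  have ends: "fst p \<in> end_space X \<Phi>" "snd p \<in> end_space Y \<Psi>" if "p \<in> R" for p
    using that sub by auto
  have step: "strand s p (Suc k) = strand s q (Suc k)"
    if pq: "p \<in> R" "q \<in> R" and eq: "strand s p k = strand s q k" for p q k
  proof (cases "odd k")
    case True
    then have "snd p (f (s k)) = snd q (f (s k))"
      using f[OF s1, of "fst p" "snd p" "fst q" "snd q"] pq eq by (simp add: strand_def)
    then have "snd p (s (Suc k)) = snd q (s (Suc k))"
      using end_space_eq_mono[OF ends(2)[OF pq(1)] ends(2)[OF pq(2)] f1[OF s1[of k]], of "s (Suc k)"] by (simp add: s_Suc)
    then show ?thesis using True by (simp add: strand_def)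
  next
    case False
    then have "fst p (g (s k)) = fst q (g (s k))"
      using g[OF s1, of "fst p" "snd p" "fst q" "snd q"] pq eq by (simp add: strand_def)
    then have "fst p (s (Suc k)) = fst q (s (Suc k))"
      using end_space_eq_mono[OF ends(1)[OF pq(1)] ends(1)[OF pq(2)] g1[OF s1[of k]], of "s (Suc k)"] by (simp add: s_Suc)
    then show ?thesis using False by (simp add: strand_def)
  qed
  define Z where "Z k = (\<lambda>p. strand s p k) ` R" for k
  define \<V> where "\<V> k w = strand s (SOME p. p \<in> R \<and> strand s p k = w) (Suc k)" for k w
  have \<V>: "\<V> k (strand s p k) = strand s p (Suc k)" if "p \<in> R" for p k
    unfolding \<V>_def using someI[of "\<lambda>q. q \<in> R \<and> strand s q k = strand s p k" p] that
    by (intro step) auto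
  have \<V>_chain: "chain_map \<V> i k (strand s p i) = strand s p k" if "p \<in> R" "i \<le> k" for p i k
    using that(2) by (induction rule: dec_induct) (simp_all add: chain_map_Suc \<V> that(1))
  have ZX: "Z k = Inl ` X (s k)" if "odd k" for k
  proof
    show "Z k \<subseteq> Inl ` X (s k)"
      using that end_space_in[OF ends(1) s1] by (auto simp: Z_def strand_def)
    show "Inl ` X (s k) \<subseteq> Z k"
    proof clarify
      fix a assume "a \<in> X (s k)"
      then obtain x where x: "x \<in> end_space X \<Phi>" "x (s k) = a"
        using end_space_through[OF D_plus_chain_surj[OF X] s1] by blast
      then obtain y where "(x, y) \<in> R" using total by blast
      then show "Inl a \<in> Z k" using x that by (force simp: Z_def strand_def)
    qed
  qed
  have ZY: "Z k = Inr ` Y (s k)" if "even k" for k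
  proof
    show "Z k \<subseteq> Inr ` Y (s k)"
      using that end_space_in[OF ends(2) s1] by (auto simp: Z_def strand_def)
    show "Inr ` Y (s k) \<subseteq> Z k"
    proof clarify
      fix b assume "b \<in> Y (s k)"
      then obtain y where y: "y \<in> end_space Y \<Psi>" "y (s k) = b"
        using end_space_through[OF D_plus_chain_surj[OF Y] s1] by blast
      then obtain x where "(x, y) \<in> R" using onto by blast
      then show "Inr b \<in> Z k" using y that by (force simp: Z_def strand_def)
    qed
  qed
  have "D_plus_chain Z \<V>"
  proof (rule D_plus_chainI)
    show "\<forall>n\<ge>1. \<V> n ` Z n = Z (Suc n)"
      by (simp add: Z_def image_image \<V> cong: image_cong)
    obtain a where "a \<in> X 1" using D_plus_chain_nonempty[OF X] by blast
    then obtain x where "x \<in> end_space X \<Phi>"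
      using end_space_through[OF D_plus_chain_surj[OF X] order_refl] by blast
    then show "Z 1 \<noteq> {}" using total unfolding Z_def by blast
    fix i j v w assume "v \<in> Z i" "w \<in> Z j"
    then obtain p q where pq: "p \<in> R" "q \<in> R" "v = strand s p i" "w = strand s q j"
      by (auto simp: Z_def)
    obtain n where n: "n \<ge> 1" "fst p n = fst q n"
      using end_space_meet[OF X ends(1)[OF pq(1)] ends(1)[OF pq(2)]] by blast
    \<comment> \<open>An odd stage beyond \<open>i\<close> and \<open>j\<close> with level at least \<open>n\<close>: there the strands show the entries
      of \<open>fst p\<close> and \<open>fst q\<close>, which agree.\<close>
    let ?k = "2 * (i + j + n) + 1"
    have "n \<le> s ?k" by (rule order_trans[OF _ s_ge]) simp
    then have "strand s p ?k = strand s q ?k"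
      using end_space_eq_mono[OF ends(1)[OF pq(1)] ends(1)[OF pq(2)] n(1) _ n(2), of "s ?k"] by (simp add: strand_def)
    then show "\<exists>k\<ge>i. k \<ge> j \<and> chain_map \<V> i k v = chain_map \<V> j k w"
      using pq by (intro exI[of _ ?k]) (simp add: \<V>_chain)
  qed
  moreover have "\<exists>\<alpha> \<beta>. index_map \<alpha> \<and> index_map \<beta> \<and>
        (\<forall>n\<ge>1. Z (2 * n - 1) = Inl ` X (\<alpha> n) \<and> Z (2 * n) = Inr ` Y (\<beta> n) \<and>
          (\<forall>x\<in>X (\<alpha> n). \<V> (2 * n) (\<V> (2 * n - 1) (Inl x)) = Inl (subchain_map \<alpha> \<Phi> n x)) \<and>
          (\<forall>y\<in>Y (\<beta> n). \<V> (2 * n + 1) (\<V> (2 * n) (Inr y)) = Inr (subchain_map \<beta> \<Psi> n y)))"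
  proof (intro exI conjI allI impI ballI)
    let ?\<alpha> = "\<lambda>n. s (2 * n - 1)" and ?\<beta> = "\<lambda>n. s (2 * n)"
    show "index_map ?\<alpha>" "index_map ?\<beta>"
      using s1 by (auto simp: index_map_def intro!: strict_mono_onI s_less)
    fix n :: nat assume n: "n \<ge> 1"
    then have odd: "odd (2 * n - 1)" and Suc: "Suc (2 * n - 1) = 2 * n" by auto
    show Zn: "Z (2 * n - 1) = Inl ` X (?\<alpha> n)" using ZX odd by blast
    show Zn': "Z (2 * n) = Inr ` Y (?\<beta> n)" using ZY by simp
    show "\<V> (2 * n) (\<V> (2 * n - 1) (Inl a)) = Inl (subchain_map ?\<alpha> \<Phi> n a)" if a_in: "a \<in> X (?\<alpha> n)" for a
    proof -
      have "Inl a \<in> Z (2 * n - 1)" unfolding Zn using a_in by (rule imageI)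
      then obtain p where p: "p \<in> R" "Inl a = strand s p (2 * n - 1)"
        unfolding Z_def by (elim imageE)
      then have a: "a = fst p (s (2 * n - 1))" using odd by (simp add: strand_def)
      have "\<V> (2 * n) (\<V> (2 * n - 1) (Inl a)) = Inl (fst p (s (Suc (2 * n))))"
        unfolding p(2) \<V>[OF p(1)] Suc by (simp add: strand_def)
      also have "fst p (s (Suc (2 * n))) = subchain_map ?\<alpha> \<Phi> n a"
        using end_space_chain_map[OF ends(1)[OF p(1)] s1 s_le[of "2 * n - 1" "Suc (2 * n)"]] a
        by (simp add: subchain_map_def)
      finally show ?thesis .
    qed
    show "\<V> (2 * n + 1) (\<V> (2 * n) (Inr b)) = Inr (subchain_map ?\<beta> \<Psi> n b)" if b_in: "b \<in> Y (?\<beta> n)" for b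
    proof -
      have "Inr b \<in> Z (2 * n)" unfolding Zn' using b_in by (rule imageI)
      then obtain p where p: "p \<in> R" "Inr b = strand s p (2 * n)"
        unfolding Z_def by (elim imageE)
      then have b: "b = snd p (s (2 * n))" by (simp add: strand_def)
      have "\<V> (2 * n + 1) (\<V> (2 * n) (Inr b)) = Inr (snd p (s (Suc (Suc (2 * n)))))"
        unfolding p(2) \<V>[OF p(1)] Suc_eq_plus1[symmetric] by (simp add: strand_def)
      also have "snd p (s (Suc (Suc (2 * n)))) = subchain_map ?\<beta> \<Psi> n b"
        using end_space_chain_map[OF ends(2)[OF p(1)] s1 s_le[of "2 * n" "Suc (Suc (2 * n))"]] b
        by (simp add: subchain_map_def)
      finally show ?thesis .
    qed
  qed
  ultimately show ?thesis unfolding common_zigzag_def by blast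
qed

theorem proposition4p7:
  fixes X :: "nat \<Rightarrow> 'a set" and \<Phi> :: "nat \<Rightarrow> 'a \<Rightarrow> 'a"
    and Y :: "nat \<Rightarrow> 'b set" and \<Psi> :: "nat \<Rightarrow> 'b \<Rightarrow> 'b"
  assumes "D_plus_chain X \<Phi>" and "D_plus_chain Y \<Psi>"
  shows "(\<exists>Z \<V>. common_zigzag X \<Phi> Y \<Psi> Z \<V>) \<longleftrightarrow>
         asymorphic (end_space X \<Phi>) end_dist (end_space Y \<Psi>) end_dist"
  using zigzag_imp_asymorphic[OF assms] asymorphic_imp_zigzag[OF assms] by blast

end
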